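(* Assume that $\epsilon\le \beta\min_{i\in A^*}|x_i^*|$ for some $0\le\beta<1/2$, and that $\delta:=\delta_{T+1}\le\frac{1-2\beta}{2\sqrt{T}+1}$. Then for any $\rho$ with $\sqrt{\rho}\in\left(\frac{2\delta\sqrt{T}+2\beta}{1-\delta},\,1\right)$, the PDASC algorithm (run with decreasing factor $\rho$) converges in finitely many steps, i.e., its outer stopping criterion $\|\Psi x(\lambda_k)-y\|\le\epsilon$ is satisfied for some finite $k$.
   Context: Setting: $\Psi\in\mathbb{R}^{n\times p}$, $p>n$, is a real matrix whose columns $\psi_1,\dots,\psi_p$ are normalized, $\|\psi_i\|=1$ (here $\|\cdot\|$ is the Euclidean norm). The true signal $x^*\in\mathbb{R}^p$ has support $A^*=\{i:x_i^*\ne0\}$ with $T=|A^*|\ge1$. The data are $y=\sum_{i\in A^*}x_i^*\psi_i+\eta\in\mathbb{R}^n$, where the noise $\eta\in\mathbb{R}^n$ satisfies $\|\eta\|\le\epsilon$ with noise level $\epsilon\ge0$. For an index set $A\subseteq\{1,\dots,p\}$, $\Psi_A$ is the submatrix of $\Psi$ with columns indexed by $A$, and $x_A$ is the subvector of $x$ indexed by $A$. Restricted isometry constant: $\delta_s$ is the smallest constant $\delta$ such that $(1-\delta)\|x\|^2\le\|\Psi x\|^2\le(1+\delta)\|x\|^2$ for all $x\in\mathbb{R}^p$ with at most $s$ nonzero components. PDASC algorithm (primal dual active set with continuation). Inputs: $\Psi,y,\epsilon$, any $\lambda_0\ge\frac12\|\Psi^ty\|_{\ell^\infty}^2$, a decreasing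 factor $\rho\in(0,1)$, and an integer $J_{max}\ge1$. Initialize $A(\lambda_0)=\emptyset$, $x(\lambda_0)=0$, $d(\lambda_0)=\Psi^ty$. For $k=1,2,\dots$: 1. Set $\lambda_k=\rho\lambda_{k-1}$, $A_0=A(\lambda_{k-1})$, $(x^0,d^0)=(x(\lambda_{k-1}),d(\lambda_{k-1}))$. 2. Inner loop, for $j=1,2,\dots,J_{max}$: set $A_j=\{i:|x_i^{j-1}+d_i^{j-1}|>\sqrt{2\lambda_k}\}$ and $I_j=\{1,\dots,p\}\setminus A_j$; define $x^j$ by $x^j_{I_j}=0$ and $\Psi_{A_j}^t\Psi_{A_j}x^j_{A_j}=\Psi_{A_j}^ty$, and $d^j=\Psi^t(y-\Psi x^j)$; leave the inner loop if $A_j=A_{j-1}$. 3. Let $\widetilde j\le J_{max}$ be the last inner index reached; set $(x(\lambda_k),d(\lambda_k))=(x^{\widetilde j},d^{\widetilde j})$ and $A(\lambda_k)=\{i:|x_i^{\widetilde j}+d_i^{\widetilde j}|>\sqrt{2\lambda_k}\}$. 4. Stop the algorithm if $\|\Psi x(\lambda_k)-y\|\le\epsilon$. *)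

theory Defs
  imports "HOL-Analysis.Analysis"
begin

text \<open>A matrix \<open>\<Psi> :: real^'p^'n\<close> has \<open>CARD('n)\<close> rows and \<open>CARD('p)\<close> columns.\<close>

definition supp :: "real^'p \<Rightarrow> 'p set" where
  "supp x = {i. x $ i \<noteq> 0}"

text \<open>The restricted isometry constant. For \<open>s \<ge> 1\<close> the minimum exists and is nonnegative;
  for \<open>s = 0\<close> every real number satisfies the condition and the value is unspecified.\<close>

definition ric :: "real^'p^'n \<Rightarrow> nat \<Rightarrow> real" where
  "ric \<Psi> s = (LEAST \<delta>. \<forall>x. card (supp x) \<le> s \<longrightarrow>
      (1 - \<delta>) * (norm x)\<^sup>2 \<le> (norm (\<Psi> *v x))\<^sup>2 \<and>
      (norm (\<Psi> *v x))\<^sup>2 \<le> (1 + \<delta>) * (norm x)\<^sup>2)"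

definition active_set :: "real \<Rightarrow> real^'p \<Rightarrow> real^'p \<Rightarrow> 'p set" where
  "active_set lam x d = {i. \<bar>x $ i + d $ i\<bar> > sqrt (2 * lam)}"

text \<open>The normal equations \<open>\<Psi>\<^sub>A\<^sup>t \<Psi>\<^sub>A x\<^sub>A = \<Psi>\<^sub>A\<^sup>t y\<close>, written entrywise: entry \<open>(i, j)\<close> of the
  Gram matrix \<open>\<Psi>\<^sub>A\<^sup>t \<Psi>\<^sub>A\<close> is the inner product of the columns \<open>i\<close> and \<open>j\<close> of \<open>\<Psi>\<close>.\<close>

definition normal_equations :: "real^'p^'n \<Rightarrow> real^'n \<Rightarrow> 'p set \<Rightarrow> real^'p \<Rightarrow> bool" where
  "normal_equations \<Psi> y A x \<longleftrightarrow>
     (\<forall>i\<in>A. (\<Sum>j\<in>A. (column i \<Psi> \<bullet> column j \<Psi>) * x $ j) = column i \<Psi> \<bullet> y)"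

text \<open>One inner iteration, from \<open>(x, d)\<close> to \<open>(A', x', d')\<close>. It is a relation rather than a
  function because the normal equations have several solutions when the columns indexed
  by \<open>A'\<close> are linearly dependent.\<close>

definition pdas_step ::
  "real^'p^'n \<Rightarrow> real^'n \<Rightarrow> real \<Rightarrow> real^'p \<Rightarrow> real^'p \<Rightarrow> 'p set \<Rightarrow> real^'p \<Rightarrow> real^'p \<Rightarrow> bool" where
  "pdas_step \<Psi> y lam x d A' x' d' \<longleftrightarrow>
     A' = active_set lam x d \<and>
     (\<forall>i. i \<notin> A' \<longrightarrow> x' $ i = 0) \<and>
     normal_equations \<Psi> y A' x' \<and>
     d' = transpose \<Psi> *v (y - \<Psi> *v x')"

text \<open>The whole inner loop for one value of \<open>lam\<close>: started at \<open>(A0, x0, d0)\<close>, it can end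
  with \<open>(x', d')\<close>. Here \<open>J\<close> is the last inner index reached.\<close>

definition pdas_inner_loop ::
  "real^'p^'n \<Rightarrow> real^'n \<Rightarrow> nat \<Rightarrow> real \<Rightarrow> 'p set \<Rightarrow> real^'p \<Rightarrow> real^'p \<Rightarrow> real^'p \<Rightarrow> real^'p \<Rightarrow> bool" where
  "pdas_inner_loop \<Psi> y Jmax lam A0 x0 d0 x' d' \<longleftrightarrow>
     (\<exists>(A :: nat \<Rightarrow> 'p set) (x :: nat \<Rightarrow> real^'p) (d :: nat \<Rightarrow> real^'p) (J :: nat).
        A 0 = A0 \<and> x 0 = x0 \<and> d 0 = d0 \<and>
        1 \<le> J \<and> J \<le> Jmax \<and>
        (\<forall>j\<in>{1..J}. pdas_step \<Psi> y lam (x (j - 1)) (d (j - 1)) (A j) (x j) (d j)) \<and>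
        (\<forall>j\<in>{1..<J}. A j \<noteq> A (j - 1)) \<and>
        (J = Jmax \<or> A J = A (J - 1)) \<and>
        x' = x J \<and> d' = d J)"

definition pdasc_stop :: "real^'p^'n \<Rightarrow> real^'n \<Rightarrow> real \<Rightarrow> real^'p \<Rightarrow> bool" where
  "pdasc_stop \<Psi> y \<epsilon> x \<longleftrightarrow> norm (\<Psi> *v x - y) \<le> \<epsilon>"

text \<open>The sequences \<open>lam\<close>, \<open>A\<close>, \<open>x\<close>, \<open>d\<close> record an execution of the algorithm, with
  \<open>x k\<close> standing for \<open>x(\<lambda>\<^sub>k)\<close> etc. Outer iteration \<open>k\<close> is executed only if the algorithm
  has not stopped at an earlier iteration; the entries after stopping are arbitrary.
  The stopping criterion is not tested for the initial values (\<open>k = 0\<close>).\<close>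

definition pdasc_run ::
  "real^'p^'n \<Rightarrow> real^'n \<Rightarrow> real \<Rightarrow> real \<Rightarrow> real \<Rightarrow> nat \<Rightarrow>
   (nat \<Rightarrow> real) \<Rightarrow> (nat \<Rightarrow> 'p set) \<Rightarrow> (nat \<Rightarrow> real^'p) \<Rightarrow> (nat \<Rightarrow> real^'p) \<Rightarrow> bool" where
  "pdasc_run \<Psi> y \<epsilon> lam0 \<rho> Jmax lam A x d \<longleftrightarrow>
     lam 0 = lam0 \<and> A 0 = {} \<and> x 0 = 0 \<and> d 0 = transpose \<Psi> *v y \<and>
     (\<forall>k\<ge>1. (\<forall>l\<in>{1..<k}. \<not> pdasc_stop \<Psi> y \<epsilon> (x l)) \<longrightarrow>
        lam k = \<rho> * lam (k - 1) \<and>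
        pdas_inner_loop \<Psi> y Jmax (lam k) (A (k - 1)) (x (k - 1)) (d (k - 1)) (x k) (d k) \<and>
        A k = active_set (lam k) (x k) (d k))"

text \<open>The normal equations are always solvable, so an execution never gets stuck.\<close>

lemma pdas_step_exists: "\<exists>A' x' d'. pdas_step \<Psi> y lam x d A' x' d'"
proof -
  define A where "A = active_set lam x d"
  define f where "f = (\<lambda>u::real^'a. \<Sum>j\<in>A. u $ j *\<^sub>R column j \<Psi>)"
  have "linear f"
    unfolding f_def
    by (intro linearI) (simp_all add: sum.distrib scaleR_add_left scaleR_sum_right)
  then have span: "span (range f) = range f"
    by (simp add: linear_subspace_image span_eq_iff)
  obtain s z where s: "s \<in> span (range f)" and z: "\<And>w. w \<in> span (range f) \<Longrightarrow> orthogonal z w"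
    and y: "y = s + z"
    by (rule orthogonal_subspace_decomp_exists[of "range f" y]) blast
  from s span obtain u where u: "s = f u" by auto
  define x' where "x' = (\<chi> i. if i \<in> A then u $ i else 0)"
  have "(\<Sum>j\<in>A. (column i \<Psi> \<bullet> column j \<Psi>) * x' $ j) = column i \<Psi> \<bullet> y" if "i \<in> A" for i
  proof -
    have "f (axis i 1) = (\<Sum>j\<in>A. if j = i then column j \<Psi> else 0)"
      unfolding f_def by (intro sum.cong) (auto simp: axis_def)
    also have "\<dots> = column i \<Psi>" using that by simp
    finally have "column i \<Psi> \<in> span (range f)" by (metis rangeI span)
    then have "column i \<Psi> \<bullet> z = 0" using z unfolding orthogonal_def by (metis inner_commute)
    then have "column i \<Psi> \<bullet> y = column i \<Psi> \<bullet> f u" by (simp add: y u inner_add_right)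
    also have "\<dots> = (\<Sum>j\<in>A. (column i \<Psi> \<bullet> column j \<Psi>) * x' $ j)"
      unfolding f_def x'_def by (simp add: inner_sum_right mult.commute)
    finally show ?thesis by simp
  qed
  then have "pdas_step \<Psi> y lam x d A x' (transpose \<Psi> *v (y - \<Psi> *v x'))"
    by (auto simp: pdas_step_def normal_equations_def A_def x'_def)
  then show ?thesis by blast
qed

end

theory Submission
  imports Defs
begin

text \<open>Fix \<open>t = (\<delta> \<surd>T + \<beta>) / (1 - \<delta>)\<close>, so that \<open>2 t < \<surd>\<rho>\<close>. If \<open>x\<close> is the least-squares solution on a
  subset \<open>A\<close> of the true support and \<open>D\<close> bounds the entries of \<open>xstar\<close> missed by \<open>A\<close> (with
  \<open>\<epsilon> \<le> \<beta> D\<close>), then \<open>x + d\<close> differs from \<open>xstar\<close> by at most \<open>t D\<close> in every entry. Hence, with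
  \<open>\<tau>\<^sub>k = \<surd>(2 \<lambda>\<^sub>k)\<close> and \<open>D = 2 \<tau>\<^sub>k\<^sub>-\<^sub>1\<close>, this error is at most \<open>\<tau>\<^sub>k\<close>: every inner step yields a subset of
  the true support that misses only entries of size at most \<open>2 \<tau>\<^sub>k\<close>. As \<open>\<tau>\<^sub>k\<close> tends to \<open>0\<close>, the active set
  eventually is the whole support, and then the residual is at most the noise.\<close>

section \<open>Restricted isometry constants\<close>

definition restricted_isometry :: "real^'p^'n \<Rightarrow> nat \<Rightarrow> real \<Rightarrow> bool" where
  "restricted_isometry \<Psi> s \<delta> \<longleftrightarrow> (\<forall>x. card (supp x) \<le> s \<longrightarrow>
      (1 - \<delta>) * (norm x)\<^sup>2 \<le> (norm (\<Psi> *v x))\<^sup>2 \<and>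
      (norm (\<Psi> *v x))\<^sup>2 \<le> (1 + \<delta>) * (norm x)\<^sup>2)"

lemma supp_axis: "supp (axis i 1 :: real^'p) = {i}"
  by (auto simp: supp_def axis_def)

lemma restricted_isometry_nonneg:
  fixes \<Psi> :: "real^'p^'n"
  assumes "\<And>i. norm (column i \<Psi>) = 1" "1 \<le> s" "restricted_isometry \<Psi> s \<delta>"
  shows "0 \<le> \<delta>"
proof -
  define e :: "real^'p" where "e = axis undefined 1"
  have "card (supp e) \<le> s" using assms(2) by (simp add: e_def supp_axis)
  moreover have "norm e = 1" "norm (\<Psi> *v e) = 1"
    using assms(1) by (simp_all add: e_def norm_axis_1 matrix_vector_mult_basis)
  ultimately show ?thesis
    using assms(3) unfolding restricted_isometry_def by force
qed

text \<open>A \<open>LEAST\<close> over the reals is informative only if the minimum is attained.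
  The admissible constants form a nonempty closed set that is bounded below, so the set contains its
  infimum.\<close>

lemma restricted_isometry_ric:
  fixes \<Psi> :: "real^'p^'n"
  assumes "\<And>i. norm (column i \<Psi>) = 1" "1 \<le> s"
  shows "restricted_isometry \<Psi> s (ric \<Psi> s)"
proof -
  define S where "S = {\<delta>. restricted_isometry \<Psi> s \<delta>}"
  have bdd: "bdd_below S"
    using restricted_isometry_nonneg[OF assms] by (auto simp: S_def intro!: bdd_belowI)
  obtain K where K: "\<And>x. norm (\<Psi> *v x) \<le> norm x * K"
    using bounded_linear.bounded[OF matrix_vector_mul_bounded_linear[of \<Psi>]] by blast
  \<comment> \<open>An operator bound \<open>K\<close> makes \<open>1 + K\<^sup>2\<close>
    admissible: the factor in the lower estimate becomes \<open>- K\<^sup>2\<close>, which is at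
    most 0.\<close>
  have "(norm (\<Psi> *v x))\<^sup>2 \<le> (1 + (1 + K\<^sup>2)) * (norm x)\<^sup>2" for x
  proof -
    have "(norm (\<Psi> *v x))\<^sup>2 \<le> (norm x * K)\<^sup>2" by (intro power_mono K) simp
    also have "\<dots> \<le> (1 + (1 + K\<^sup>2)) * (norm x)\<^sup>2"
      by (simp add: power_mult_distrib algebra_simps)
    finally show ?thesis .
  qed
  moreover have "(1 - (1 + K\<^sup>2)) * (norm x)\<^sup>2 \<le> (norm (\<Psi> *v x))\<^sup>2" for x
    by (rule order_trans[of _ 0]) (simp_all add: mult_nonpos_nonneg)
  ultimately have "1 + K\<^sup>2 \<in> S"
    unfolding S_def restricted_isometry_def by blast
  then have ne: "S \<noteq> {}" by blast
  have "closed S"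
    unfolding S_def restricted_isometry_def
    by (intro closed_Collect_all closed_Collect_imp closed_Collect_conj closed_Collect_le
        open_Collect_const continuous_intros)
  then have "Inf S \<in> S" by (rule closed_contains_Inf[OF ne bdd])
  moreover have "ric \<Psi> s = Inf S"
  proof -
    have "ric \<Psi> s = (LEAST \<delta>. \<delta> \<in> S)"
      by (simp add: ric_def S_def restricted_isometry_def)
    also have "\<dots> = Inf S"
      using \<open>Inf S \<in> S\<close> bdd by (intro Least_equality cInf_lower)
    finally show ?thesis .
  qed
  ultimately show ?thesis by (simp add: S_def)
qed

text \<open>Polarization: the isometry property bounds the quadratic form \<open>B z z\<close> for
  all \<open>z\<close> supported in \<open>S\<close>, and this controls the bilinear form.\<close>

lemma restricted_isometry_inner:
  fixes \<Psi> :: "real^'p^'n"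
  assumes rip: "restricted_isometry \<Psi> s \<delta>"
    and S: "card S \<le> s" "supp u \<subseteq> S" "supp v \<subseteq> S"
  shows "\<bar>(\<Psi> *v u) \<bullet> (\<Psi> *v v) - u \<bullet> v\<bar> \<le> \<delta> * norm u * norm v"
proof -
  define B where "B = (\<lambda>z w. (\<Psi> *v z) \<bullet> (\<Psi> *v w) - z \<bullet> w)"
  define a b where "a = norm u" and "b = norm v"
  have quad: "\<bar>B z z\<bar> \<le> \<delta> * (z \<bullet> z)" if "supp z \<subseteq> S" for z
  proof -
    have "card (supp z) \<le> s" using card_mono[OF finite that] S(1) by linarith
    then have "(1 - \<delta>) * (z \<bullet> z) \<le> (\<Psi> *v z) \<bullet> (\<Psi> *v z)"
      and "(\<Psi> *v z) \<bullet> (\<Psi> *v z) \<le> (1 + \<delta>) * (z \<bullet> z)"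
      using rip unfolding restricted_isometry_def power2_norm_eq_inner by blast+
    then show ?thesis unfolding B_def by (simp add: algebra_simps)
  qed
  show ?thesis
  proof (cases "u = 0 \<or> v = 0")
    case True
    then show ?thesis by auto
  next
    case False
    then have pos: "0 < a" "0 < b" by (simp_all add: a_def b_def)
    \<comment> \<open>Cross-scaling gives both summands the norm \<open>a * b\<close>, so that the
      parallelogram law produces the product of the norms; unscaled vectors would give only the mean
      of \<open>a\<^sup>2\<close> and \<open>b\<^sup>2\<close>.\<close>
    define p q where "p = b *\<^sub>R u + a *\<^sub>R v" and "q = b *\<^sub>R u - a *\<^sub>R v"
    have "supp p \<subseteq> S" "supp q \<subseteq> S" using S by (fastforce simp: supp_def p_def q_def)+
    then have pq: "\<bar>B p p\<bar> \<le> \<delta> * (p \<bullet> p)" "\<bar>B q q\<bar> \<le> \<delta> * (q \<bullet> q)" by (simp_all add: quad)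
    have B4: "4 * (a * b) * B u v = B p p - B q q"
      unfolding B_def p_def q_def
      by (simp add: matrix_vector_right_distrib matrix_vector_mult_diff_distrib
          matrix_vector_mult_scaleR inner_add_left inner_add_right inner_diff_left
          inner_diff_right inner_commute algebra_simps)
    have "u \<bullet> u = a\<^sup>2" "v \<bullet> v = b\<^sup>2" by (simp_all add: a_def b_def power2_norm_eq_inner)
    then have "p \<bullet> p + q \<bullet> q = 4 * (a * b)\<^sup>2"
      unfolding p_def q_def
      by (simp add: inner_add_left inner_add_right inner_diff_left inner_diff_right inner_commute
          power2_eq_square algebra_simps)
    moreover have "\<bar>B p p - B q q\<bar> \<le> \<delta> * (p \<bullet> p + q \<bullet> q)"
      using pq by (simp add: distrib_left)
    ultimately have "\<bar>4 * (a * b) * B u v\<bar> \<le> \<delta> * (4 * (a * b)\<^sup>2)"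
      unfolding B4 by simp
    then have "4 * (a * b) * \<bar>B u v\<bar> \<le> 4 * (a * b) * (\<delta> * a * b)"
      using pos by (simp add: abs_mult power2_eq_square algebra_simps)
    then show ?thesis using pos by (simp add: B_def a_def b_def)
  qed
qed

section \<open>Least squares on an index set\<close>

text \<open>The normal equations characterize the minimizers of the residual norm among vectors
  vanishing off \<open>A\<close>; dependent columns allow several of them.\<close>

definition least_squares_on :: "real^'p^'n \<Rightarrow> real^'n \<Rightarrow> 'p set \<Rightarrow> real^'p \<Rightarrow> bool" where
  "least_squares_on \<Psi> y A x \<longleftrightarrow> (\<forall>i. i \<notin> A \<longrightarrow> x $ i = 0) \<and> normal_equations \<Psi> y A x"

lemma mult_vec_eq_sum_columns:
  fixes \<Psi> :: "real^'p^'n"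
  assumes "supp z \<subseteq> A"
  shows "\<Psi> *v z = (\<Sum>j\<in>A. z $ j *\<^sub>R column j \<Psi>)"
proof -
  have "\<Psi> *v z = (\<Sum>j\<in>UNIV. z $ j *\<^sub>R column j \<Psi>)"
    by (simp add: matrix_mult_sum scalar_mult_eq_scaleR)
  also have "\<dots> = (\<Sum>j\<in>A. z $ j *\<^sub>R column j \<Psi>)"
    using assms by (intro sum.mono_neutral_right) (auto simp: supp_def)
  finally show ?thesis .
qed

lemma transpose_mult_component: "(transpose \<Psi> *v v) $ i = column i \<Psi> \<bullet> v"
  for \<Psi> :: "real^'p^'n"
  by (simp add: matrix_vector_mult_def transpose_def column_def inner_vec_def)

lemma least_squares_on_orthogonal:
  fixes \<Psi> :: "real^'p^'n"
  assumes lsq: "least_squares_on \<Psi> y A x" and z: "supp z \<subseteq> A"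
  shows "(\<Psi> *v z) \<bullet> (y - \<Psi> *v x) = 0"
proof -
  have x: "\<Psi> *v x = (\<Sum>j\<in>A. x $ j *\<^sub>R column j \<Psi>)"
    using lsq by (intro mult_vec_eq_sum_columns) (auto simp: supp_def least_squares_on_def)
  have "column i \<Psi> \<bullet> (y - \<Psi> *v x) = 0" if "i \<in> A" for i
    using lsq that unfolding x
    by (simp add: least_squares_on_def normal_equations_def inner_diff_right inner_sum_right
        mult.commute)
  then show ?thesis
    by (simp add: mult_vec_eq_sum_columns[OF z] inner_sum_left)
qed

text \<open>Pythagoras: the noise splits into the residual and \<open>\<Psi> *v (x - w)\<close>,
  which are orthogonal as \<open>x - w\<close> is supported in \<open>A\<close>.\<close>

lemma least_squares_on_residual_le:
  fixes \<Psi> :: "real^'p^'n"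
  assumes lsq: "least_squares_on \<Psi> (\<Psi> *v w + \<eta>) A x" and "supp w \<subseteq> A"
  shows "norm (\<Psi> *v x - (\<Psi> *v w + \<eta>)) \<le> norm \<eta>"
proof -
  define r where "r = \<Psi> *v w + \<eta> - \<Psi> *v x"
  have "supp (x - w) \<subseteq> A"
    using assms by (auto simp: supp_def least_squares_on_def)
  then have "(\<Psi> *v (x - w)) \<bullet> r = 0"
    unfolding r_def by (rule least_squares_on_orthogonal[OF lsq])
  moreover have "\<eta> = r + \<Psi> *v (x - w)"
    by (simp add: r_def matrix_vector_mult_diff_distrib)
  ultimately have "(norm \<eta>)\<^sup>2 = (norm r)\<^sup>2 + (norm (\<Psi> *v (x - w)))\<^sup>2"
    by (simp add: power2_norm_eq_inner inner_add_left inner_add_right inner_commute)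
  then have "(norm r)\<^sup>2 \<le> (norm \<eta>)\<^sup>2" by simp
  then have "norm r \<le> norm \<eta>" by (rule power2_le_imp_le) simp
  then show ?thesis by (simp add: r_def norm_minus_commute)
qed

text \<open>The error splits into \<open>g\<close> on \<open>A\<close> and the missed part
  \<open>h\<close>. Testing the orthogonality of the residual with \<open>g\<close> bounds
  \<open>g\<close> by \<open>\<delta> * norm h + \<epsilon>\<close>, up to the factor
  \<open>1 - \<delta>\<close>; adding \<open>h\<close> completes the bound.\<close>

lemma least_squares_on_error:
  fixes \<Psi> :: "real^'p^'n"
  assumes rip: "restricted_isometry \<Psi> s \<delta>" and \<delta>: "0 \<le> \<delta>" "\<delta> < 1"
    and lsq: "least_squares_on \<Psi> (\<Psi> *v xs + \<eta>) A x"
    and A: "A \<subseteq> supp xs" and s: "card (supp xs) \<le> s"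
    and \<eta>: "norm \<eta> \<le> \<epsilon>"
    and h_def: "h = (\<chi> i. if i \<in> A then 0 else xs $ i)"
  shows "(1 - \<delta>) * norm (xs - x) \<le> norm h + \<epsilon>"
proof -
  define g where "g = xs - x - h"
  define a b q where "a = norm g" and "b = norm h" and "q = norm (\<Psi> *v g)"
  have suppg: "supp g \<subseteq> A"
    using lsq by (auto simp: supp_def g_def h_def least_squares_on_def)
  have supph: "supp h \<subseteq> supp xs" by (auto simp: supp_def h_def)
  have gh: "g \<bullet> h = 0"
    unfolding inner_vec_def
    using lsq by (intro sum.neutral) (simp add: g_def h_def least_squares_on_def)
  have nonneg: "0 \<le> a" "0 \<le> b" "0 \<le> q" "0 \<le> \<epsilon>"
    using order_trans[OF norm_ge_zero \<eta>] by (simp_all add: a_def b_def q_def)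
  have "\<Psi> *v xs + \<eta> - \<Psi> *v x = \<Psi> *v g + \<Psi> *v h + \<eta>"
    by (simp add: g_def matrix_vector_mult_diff_distrib)
  with least_squares_on_orthogonal[OF lsq suppg]
  have "(\<Psi> *v g) \<bullet> (\<Psi> *v g + \<Psi> *v h + \<eta>) = 0" by (simp only:)
  then have "q\<^sup>2 = - ((\<Psi> *v g) \<bullet> (\<Psi> *v h)) - (\<Psi> *v g) \<bullet> \<eta>"
    by (simp add: q_def power2_norm_eq_inner inner_add_right)
  moreover have "\<bar>(\<Psi> *v g) \<bullet> (\<Psi> *v h)\<bar> \<le> \<delta> * a * b"
    using restricted_isometry_inner[OF rip s order_trans[OF suppg A] supph] gh
    by (simp add: a_def b_def)
  moreover have "\<bar>(\<Psi> *v g) \<bullet> \<eta>\<bar> \<le> q * \<epsilon>"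
    using Cauchy_Schwarz_ineq2[of "\<Psi> *v g" \<eta>] mult_left_mono[OF \<eta> nonneg(3)]
    by (simp add: q_def)
  ultimately have q2: "q * (q - \<epsilon>) \<le> \<delta> * a * b"
    by (simp add: power2_eq_square algebra_simps)
  have "card (supp g) \<le> s"
    using card_mono[of "supp xs" "supp g"] suppg A s by fastforce
  then have "(1 - \<delta>) * a\<^sup>2 \<le> q\<^sup>2"
    using rip by (simp add: restricted_isometry_def a_def q_def)
  define c where "c = sqrt (1 - \<delta>)"
  have c: "0 < c" "c \<le> 1" "c\<^sup>2 = 1 - \<delta>" using \<delta> by (simp_all add: c_def)
  have ca: "c * a \<le> q"
  proof (rule power2_le_imp_le)
    show "(c * a)\<^sup>2 \<le> q\<^sup>2"
      unfolding power_mult_distrib c(3) by fact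
  qed (rule nonneg(3))
  \<comment> \<open>Otherwise \<open>c * a\<close> is at least \<open>\<epsilon>\<close>. The map
    sending \<open>s\<close> to \<open>s * (s - \<epsilon>)\<close> increases from there on, so
    \<open>q\<close> may be replaced by its lower bound \<open>c * a\<close>, and
    \<open>c \<le> 1\<close> contradicts \<open>q2\<close>.\<close>
  have "(1 - \<delta>) * a \<le> \<delta> * b + \<epsilon>"
  proof (rule ccontr)
    assume "\<not> ?thesis"
    then have less: "\<delta> * b + \<epsilon> < (1 - \<delta>) * a" by simp
    have db: "0 \<le> \<delta> * b" using \<delta> nonneg by simp
    have "0 < (1 - \<delta>) * a" using less db nonneg(4) by linarith
    then have "0 < a" using \<delta> by (simp add: zero_less_mult_iff)
    have "c\<^sup>2 * a \<le> c * a"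
      using mult_left_le[of c c] c(1,2) \<open>0 < a\<close> by (intro mult_right_mono) (simp_all add: power2_eq_square)
    then have "\<epsilon> \<le> c * a" using less db c(3) by simp
    have "a * (\<delta> * b) < a * ((1 - \<delta>) * a - \<epsilon>)"
      using less \<open>0 < a\<close> by simp
    also have "\<dots> \<le> c * a * (c * a - \<epsilon>)"
      using c \<open>0 < a\<close> nonneg mult_right_mono[OF c(2), of "a * \<epsilon>"]
      by (simp add: power2_eq_square algebra_simps flip: c(3))
    also have "\<dots> \<le> q * (q - \<epsilon>)"
      using ca \<open>\<epsilon> \<le> c * a\<close> nonneg(3) by (intro mult_mono) auto
    finally show False using q2 by (simp add: algebra_simps)
  qed
  moreover have "norm (xs - x) \<le> b + a"
    using norm_triangle_ineq[of h g] by (simp add: g_def a_def b_def)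
  then have "(1 - \<delta>) * norm (xs - x) \<le> (1 - \<delta>) * (b + a)"
    using \<delta> by (intro mult_left_mono) auto
  ultimately show ?thesis by (simp add: b_def algebra_simps)
qed

text \<open>With \<open>w = xs - x\<close>, the dual entry is \<open>w $ i\<close> up to an isometry
  defect and a noise term, so adding it to \<open>x $ i\<close> nearly restores
  \<open>xs $ i\<close>.\<close>

lemma primal_plus_dual_error:
  fixes \<Psi> :: "real^'p^'n"
  assumes rip: "restricted_isometry \<Psi> (card (supp xs) + 1) \<delta>" and \<delta>: "0 \<le> \<delta>" "\<delta> < 1"
    and col: "norm (column i \<Psi>) = 1"
    and y: "y = \<Psi> *v xs + \<eta>"
    and lsq: "least_squares_on \<Psi> y A x" and A: "A \<subseteq> supp xs"
    and \<eta>: "norm \<eta> \<le> \<epsilon>"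
    and D: "\<And>j. j \<notin> A \<Longrightarrow> \<bar>xs $ j\<bar> \<le> D" and \<epsilon>: "\<epsilon> \<le> \<beta> * D" and "0 \<le> D"
  shows "\<bar>x $ i + (transpose \<Psi> *v (y - \<Psi> *v x)) $ i - xs $ i\<bar>
    \<le> (\<delta> * sqrt (card (supp xs)) + \<beta>) / (1 - \<delta>) * D"
proof -
  define T where "T = card (supp xs)"
  define w where "w = xs - x"
  define h :: "real^'p" where "h = (\<chi> i. if i \<in> A then 0 else xs $ i)"
  have "(norm h)\<^sup>2 = (\<Sum>j\<in>UNIV. (h $ j)\<^sup>2)"
    by (simp add: norm_vec_def L2_set_def sum_nonneg)
  also have "\<dots> = (\<Sum>j\<in>supp xs. (h $ j)\<^sup>2)"
    by (intro sum.mono_neutral_right) (auto simp: supp_def h_def)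
  also have "\<dots> \<le> (\<Sum>j\<in>supp xs. D\<^sup>2)"
    using D \<open>0 \<le> D\<close> by (intro sum_mono) (auto simp: h_def abs_le_square_iff[symmetric])
  also have "\<dots> = (sqrt T * D)\<^sup>2" by (simp add: T_def power_mult_distrib)
  finally have h: "norm h \<le> sqrt T * D" by (rule power2_le_imp_le) (use \<open>0 \<le> D\<close> in simp)
  have "(1 - \<delta>) * norm w \<le> norm h + \<epsilon>"
    unfolding w_def
    using least_squares_on_error[OF rip \<delta> lsq[unfolded y] A _ \<eta> h_def] by simp
  then have w: "(1 - \<delta>) * norm w \<le> sqrt T * D + \<epsilon>" using h by simp
  have "supp w \<subseteq> supp xs"
    using lsq A by (auto simp: supp_def w_def least_squares_on_def)
  \<comment> \<open>The index \<open>i\<close> may lie outside the support; this is why the isometry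
    order is one more than the support size.\<close>
  moreover have "card (insert i (supp xs)) \<le> card (supp xs) + 1"
    by (simp add: card_insert_if)
  ultimately have "\<bar>(\<Psi> *v axis i 1) \<bullet> (\<Psi> *v w) - axis i 1 \<bullet> w\<bar> \<le> \<delta> * norm (axis i 1 :: real^'p) * norm w"
    by (intro restricted_isometry_inner[OF rip, of "insert i (supp xs)"]) (auto simp: supp_axis)
  then have 1: "\<bar>column i \<Psi> \<bullet> (\<Psi> *v w) - w $ i\<bar> \<le> \<delta> * norm w"
    by (simp add: matrix_vector_mult_basis inner_axis' norm_axis_1)
  have 2: "\<bar>column i \<Psi> \<bullet> \<eta>\<bar> \<le> \<epsilon>"
    using Cauchy_Schwarz_ineq2[of "column i \<Psi>" \<eta>] col \<eta> by simp
  have "x $ i + (transpose \<Psi> *v (y - \<Psi> *v x)) $ i - xs $ i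
      = column i \<Psi> \<bullet> (\<Psi> *v w) - w $ i + column i \<Psi> \<bullet> \<eta>"
    unfolding transpose_mult_component
    by (simp add: y w_def matrix_vector_mult_diff_distrib inner_add_right inner_diff_right)
  also have "\<bar>\<dots>\<bar> \<le> \<delta> * norm w + \<epsilon>" using 1 2 by linarith
  also have "\<dots> \<le> (\<delta> * sqrt T + \<beta>) / (1 - \<delta>) * D"
  proof -
    \<comment> \<open>After multiplication by \<open>1 - \<delta>\<close> the noise contributions
      \<open>\<delta> * \<epsilon>\<close> and \<open>(1 - \<delta>) * \<epsilon>\<close> add up to
      a single \<open>\<epsilon>\<close>.\<close>
    have "\<delta> * ((1 - \<delta>) * norm w) \<le> \<delta> * (sqrt T * D + \<epsilon>)"
      using w \<delta>(1) by (rule mult_left_mono)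
    then have "(\<delta> * norm w + \<epsilon>) * (1 - \<delta>) \<le> (\<delta> * sqrt T + \<beta>) * D"
      using \<epsilon> by (simp add: algebra_simps)
    then show ?thesis using \<delta>(2) by (simp add: pos_le_divide_eq)
  qed
  finally show ?thesis by (simp add: T_def)
qed

section \<open>Thresholding and the inner loop\<close>

text \<open>If the error is within the threshold, a zero entry of \<open>xs\<close> cannot exceed
  it, and an entry left out is at most threshold plus error.\<close>

lemma pdas_step_active_set:
  fixes \<Psi> :: "real^'p^'n"
  assumes step: "pdas_step \<Psi> y lam x d A' x' d'"
    and err: "\<And>i. \<bar>x $ i + d $ i - xs $ i\<bar> \<le> sqrt (2 * lam)"
  shows "A' \<subseteq> supp xs" "\<And>i. i \<notin> A' \<Longrightarrow> \<bar>xs $ i\<bar> \<le> 2 * sqrt (2 * lam)"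
    "least_squares_on \<Psi> y A' x'" "d' = transpose \<Psi> *v (y - \<Psi> *v x')"
proof -
  have A': "A' = active_set lam x d" using step by (simp add: pdas_step_def)
  show "A' \<subseteq> supp xs"
  proof
    fix i assume "i \<in> A'"
    then show "i \<in> supp xs" using err[of i] by (auto simp: A' active_set_def supp_def)
  qed
  show "\<bar>xs $ i\<bar> \<le> 2 * sqrt (2 * lam)" if "i \<notin> A'" for i
    using that err[of i] by (auto simp: A' active_set_def)
  show "least_squares_on \<Psi> y A' x'" "d' = transpose \<Psi> *v (y - \<Psi> *v x')"
    using step by (auto simp: pdas_step_def least_squares_on_def)
qed

text \<open>The invariant of both loops. The witness \<open>A\<close> is the set on which
  \<open>x\<close> was computed, which may differ from the active set read off from \<open>x\<close>
  and \<open>d\<close> afterwards.\<close>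

definition good_state ::
  "real^'p^'n \<Rightarrow> real^'n \<Rightarrow> real^'p \<Rightarrow> real \<Rightarrow> real^'p \<Rightarrow> real^'p \<Rightarrow> bool" where
  "good_state \<Psi> y xs D x d \<longleftrightarrow> d = transpose \<Psi> *v (y - \<Psi> *v x) \<and>
     (\<exists>A\<subseteq>supp xs. least_squares_on \<Psi> y A x \<and> (\<forall>i. i \<notin> A \<longrightarrow> \<bar>xs $ i\<bar> \<le> D))"

lemma good_state_mono: "good_state \<Psi> y xs D x d \<Longrightarrow> D \<le> D' \<Longrightarrow> good_state \<Psi> y xs D' x d"
  unfolding good_state_def by (meson order_trans)

text \<open>The bound \<open>D\<close> comes from the previous, larger \<open>\<lambda>\<close>; the first inner step already improves it.\<close>

lemma pdas_inner_loop_good_state: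
  fixes \<Psi> :: "real^'p^'n"
  assumes loop: "pdas_inner_loop \<Psi> y Jmax lam A0 x0 d0 x' d'"
    and init: "good_state \<Psi> y xs D x0 d0"
    and err: "\<And>x d i. good_state \<Psi> y xs D x d \<Longrightarrow> \<bar>x $ i + d $ i - xs $ i\<bar> \<le> sqrt (2 * lam)"
    and D: "2 * sqrt (2 * lam) \<le> D"
  shows "good_state \<Psi> y xs (2 * sqrt (2 * lam)) x' d'"
proof -
  obtain A x d and J :: nat where 0: "x 0 = x0" "d 0 = d0" and J: "1 \<le> J" and last: "x' = x J" "d' = d J"
    and step: "\<And>j. j \<in> {1..J} \<Longrightarrow> pdas_step \<Psi> y lam (x (j - 1)) (d (j - 1)) (A j) (x j) (d j)"
    using loop unfolding pdas_inner_loop_def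
    by (elim exE conjE) (rule that, assumption+, erule (1) bspec)
  have next_good: "good_state \<Psi> y xs (2 * sqrt (2 * lam)) (x (Suc j)) (d (Suc j))"
    if "Suc j \<le> J" "good_state \<Psi> y xs D (x j) (d j)" for j
  proof -
    have "pdas_step \<Psi> y lam (x j) (d j) (A (Suc j)) (x (Suc j)) (d (Suc j))"
      using step[of "Suc j"] that(1) by simp
    from pdas_step_active_set[OF this err[OF that(2)]]
    show ?thesis unfolding good_state_def by blast
  qed
  \<comment> \<open>The error bound is available for \<open>D\<close>, so each improved state is
    weakened back to \<open>D\<close> before the next step.\<close>
  have "good_state \<Psi> y xs D (x j) (d j)" if "j \<le> J" for j
    using that
  proof (induction j)
    case 0
    then show ?case using init \<open>x 0 = x0\<close> \<open>d 0 = d0\<close> by simp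
  next
    case (Suc j)
    then show ?case using good_state_mono[OF next_good D] by simp
  qed
  \<comment> \<open>\<open>1 \<le> J\<close> guarantees at least one inner step, and the last one
    gives the improved bound.\<close>
  from next_good[OF _ this, of "J - 1"] J show ?thesis by (simp add: last)
qed

text \<open>A set containing the whole support would bring the residual down to the noise level. A
  run that continues has therefore missed a nonzero entry, which keeps \<open>D\<close> above the
  smallest one.\<close>

lemma good_state_not_stop:
  fixes \<Psi> :: "real^'p^'n"
  assumes good: "good_state \<Psi> y xs D x d" and y: "y = \<Psi> *v xs + \<eta>" and \<eta>: "norm \<eta> \<le> \<epsilon>"
    and "\<not> pdasc_stop \<Psi> y \<epsilon> x"
  obtains i where "i \<in> supp xs" "\<bar>xs $ i\<bar> \<le> D"
proof -
  obtain A where A: "least_squares_on \<Psi> y A x" "\<And>i. i \<notin> A \<Longrightarrow> \<bar>xs $ i\<bar> \<le> D"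
    using good unfolding good_state_def by blast
  have "\<not> supp xs \<subseteq> A"
    using least_squares_on_residual_le[of \<Psi> xs \<eta> A x] A(1) \<eta> assms(4)
    by (auto simp: y pdasc_stop_def)
  then show thesis using A(2) that by blast
qed

lemma good_state_error:
  fixes \<Psi> :: "real^'p^'n"
  assumes "good_state \<Psi> y xs D x d"
    and "restricted_isometry \<Psi> (card (supp xs) + 1) \<delta>" "0 \<le> \<delta>" "\<delta> < 1"
    and "norm (column i \<Psi>) = 1" "y = \<Psi> *v xs + \<eta>" "norm \<eta> \<le> \<epsilon>" "\<epsilon> \<le> \<beta> * D" "0 \<le> D"
  shows "\<bar>x $ i + d $ i - xs $ i\<bar> \<le> (\<delta> * sqrt (card (supp xs)) + \<beta>) / (1 - \<delta>) * D"
  using assms primal_plus_dual_error[of \<Psi> xs \<delta> i y \<eta> _ x \<epsilon> D \<beta>]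
  unfolding good_state_def by blast

text \<open>For the empty set, \<open>D\<close> may be the largest entry \<open>M\<close> of
  \<open>xs\<close> in absolute value. The dual vector is then at least \<open>M / 2\<close> at that
  entry, and the choice of \<open>lam\<close> dominates the dual vector.\<close>

lemma good_state_initial:
  fixes \<Psi> :: "real^'p^'n"
  assumes err: "\<And>D i. good_state \<Psi> y xs D 0 (transpose \<Psi> *v y) \<Longrightarrow> m \<le> D \<Longrightarrow>
      \<bar>(transpose \<Psi> *v y) $ i - xs $ i\<bar> \<le> D / 2"
    and m: "\<And>i. i \<in> supp xs \<Longrightarrow> m \<le> \<bar>xs $ i\<bar>" and "supp xs \<noteq> {}"
    and lam: "lam \<ge> 1 / 2 * (infnorm (transpose \<Psi> *v y))\<^sup>2"
  shows "good_state \<Psi> y xs (2 * sqrt (2 * lam)) 0 (transpose \<Psi> *v y)" "m \<le> 2 * sqrt (2 * lam)"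
proof -
  define d where "d = transpose \<Psi> *v y"
  have good: "good_state \<Psi> y xs D 0 d" if "\<And>i. \<bar>xs $ i\<bar> \<le> D" for D
    unfolding good_state_def
    using that by (auto simp: d_def least_squares_on_def normal_equations_def intro!: exI[of _ "{}"])
  define M where "M = Max (range (\<lambda>i. \<bar>xs $ i\<bar>))"
  have le_M: "\<bar>xs $ i\<bar> \<le> M" for i by (simp add: M_def)
  have "M \<in> range (\<lambda>i. \<bar>xs $ i\<bar>)" unfolding M_def by (intro Max_in) auto
  then obtain k where k: "M = \<bar>xs $ k\<bar>" by blast
  have "m \<le> M" using m le_M \<open>supp xs \<noteq> {}\<close> by (meson all_not_in_conv order_trans)
  have "\<bar>d $ k - xs $ k\<bar> \<le> M / 2"
    using err[of M k] good[of M] le_M \<open>m \<le> M\<close> by (simp add: d_def)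
  then have "M / 2 \<le> \<bar>d $ k\<bar>" using k by linarith
  also have "\<dots> \<le> infnorm d" using component_le_infnorm_cart .
  also have "\<dots> \<le> sqrt (2 * lam)"
    using lam by (intro real_le_rsqrt) (simp add: d_def)
  finally have "M \<le> 2 * sqrt (2 * lam)" by simp
  then show "good_state \<Psi> y xs (2 * sqrt (2 * lam)) 0 (transpose \<Psi> *v y)" "m \<le> 2 * sqrt (2 * lam)"
    using good le_M \<open>m \<le> M\<close> unfolding d_def by (meson order_trans)+
qed

section \<open>The outer loop with geometrically decreasing thresholds\<close>

theorem theorem3p2:
  fixes \<Psi> :: "real^'p^'n"
    and xstar :: "real^'p"
    and y \<eta> :: "real^'n"
    and \<epsilon> \<beta> \<delta> \<rho> lam0 :: real
    and T Jmax :: nat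
    and lam :: "nat \<Rightarrow> real"
    and A :: "nat \<Rightarrow> 'p set"
    and x d :: "nat \<Rightarrow> real^'p"
  assumes "CARD('p) > CARD('n)"
    and "\<And>i. norm (column i \<Psi>) = 1"
    and "T = card (supp xstar)" and "T \<ge> 1"
    and "y = (\<Sum>i\<in>supp xstar. xstar $ i *\<^sub>R column i \<Psi>) + \<eta>"
    and "\<epsilon> \<ge> 0" and "norm \<eta> \<le> \<epsilon>"
    and "0 \<le> \<beta>" and "\<beta> < 1 / 2"
    and "\<epsilon> \<le> \<beta> * Min ((\<lambda>i. \<bar>xstar $ i\<bar>) ` supp xstar)"
    and "\<delta> = ric \<Psi> (T + 1)"
    and "\<delta> \<le> (1 - 2 * \<beta>) / (2 * sqrt (real T) + 1)"
    and "0 < \<rho>" and "\<rho> < 1"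
    and "sqrt \<rho> \<in> {(2 * \<delta> * sqrt (real T) + 2 * \<beta>) / (1 - \<delta>) <..< 1}"
    and "lam0 \<ge> 1 / 2 * (infnorm (transpose \<Psi> *v y))\<^sup>2"
    and "Jmax \<ge> 1"
    and "pdasc_run \<Psi> y \<epsilon> lam0 \<rho> Jmax lam A x d"
  shows "\<exists>k\<ge>1. pdasc_stop \<Psi> y \<epsilon> (x k)"
proof (rule ccontr)
  assume "\<not> ?thesis"
  then have nostop: "\<not> pdasc_stop \<Psi> y \<epsilon> (x k)" if "1 \<le> k" for k using that by blast
  define m where "m = Min ((\<lambda>i. \<bar>xstar $ i\<bar>) ` supp xstar)"
  define \<tau> where "\<tau> k = sqrt (2 * lam k)" for k
  define t where "t = (\<delta> * sqrt T + \<beta>) / (1 - \<delta>)"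
  have ne: "supp xstar \<noteq> {}" using assms(3,4) by auto
  have m_le: "m \<le> \<bar>xstar $ i\<bar>" if "i \<in> supp xstar" for i using that by (simp add: m_def)
  have "m \<in> (\<lambda>i. \<bar>xstar $ i\<bar>) ` supp xstar" unfolding m_def using ne by (intro Min_in) auto
  then have "0 < m" by (auto simp: supp_def)
  have y: "y = \<Psi> *v xstar + \<eta>" using assms(5) by (simp add: mult_vec_eq_sum_columns[OF order_refl])
  have rip: "restricted_isometry \<Psi> (card (supp xstar) + 1) \<delta>"
    unfolding assms(11) assms(3) by (intro restricted_isometry_ric assms(2)) simp
  have "0 \<le> \<delta>" by (rule restricted_isometry_nonneg[OF assms(2) _ rip]) simp
  have "(1 - 2 * \<beta>) / (2 * sqrt T + 1) < 1"
  proof -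
    have "0 < sqrt T" using assms(4) by simp
    moreover from this have "1 - 2 * \<beta> < 2 * sqrt T + 1" using assms(8) by linarith
    ultimately show ?thesis by (simp only: divide_less_eq_1_pos)
  qed
  then have "\<delta> < 1" using assms(12) by simp
  have t: "2 * t < sqrt \<rho>" "sqrt \<rho> < 1" using assms(15) by (simp_all add: t_def algebra_simps)
  \<comment> \<open>The noise level is tied to the smallest entry \<open>m\<close>;
    \<open>m \<le> D\<close> transfers this bound to \<open>D\<close>.\<close>
  have err: "\<bar>x' $ i + d' $ i - xstar $ i\<bar> \<le> t * D"
    if "good_state \<Psi> y xstar D x' d'" "m \<le> D" for x' d' D i
  proof -
    have "\<epsilon> \<le> \<beta> * D"
      using assms(10) mult_left_mono[OF that(2) assms(8)] by (simp add: m_def)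
    then show ?thesis
      using good_state_error[OF that(1) rip \<open>0 \<le> \<delta>\<close> \<open>\<delta> < 1\<close> assms(2) y assms(7), of \<beta> i]
        that(2) \<open>0 < m\<close> by (simp add: t_def assms(3))
  qed
  have x0: "x 0 = 0" "d 0 = transpose \<Psi> *v y" "lam 0 = lam0"
    and lam: "lam (Suc k) = \<rho> * lam k"
    and loop: "pdas_inner_loop \<Psi> y Jmax (lam (Suc k)) (A k) (x k) (d k) (x (Suc k)) (d (Suc k))" for k
  proof -
    show "x 0 = 0" "d 0 = transpose \<Psi> *v y" "lam 0 = lam0"
      using assms(18) unfolding pdasc_run_def by blast+
    \<comment> \<open>The recursion in \<open>pdasc_run\<close> is guarded by not having stopped, so
      the contradiction hypothesis makes it hold for every \<open>k\<close>.\<close>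
    have "\<forall>l\<in>{1..<Suc k}. \<not> pdasc_stop \<Psi> y \<epsilon> (x l)" using nostop by simp
    then have "lam (Suc k) = \<rho> * lam (Suc k - 1) \<and> pdas_inner_loop \<Psi> y Jmax (lam (Suc k))
        (A (Suc k - 1)) (x (Suc k - 1)) (d (Suc k - 1)) (x (Suc k)) (d (Suc k))"
      using assms(18) unfolding pdasc_run_def by (metis le_add1 plus_1_eq_Suc)
    then show "lam (Suc k) = \<rho> * lam k"
      "pdas_inner_loop \<Psi> y Jmax (lam (Suc k)) (A k) (x k) (d k) (x (Suc k)) (d (Suc k))"
      unfolding diff_Suc_1 by blast+
  qed
  have \<tau>_Suc: "\<tau> (Suc k) = sqrt \<rho> * \<tau> k" for k
    by (simp add: \<tau>_def lam real_sqrt_mult)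
  \<comment> \<open>The second conjunct makes \<open>err\<close> applicable at
    \<open>2 * \<tau> k\<close> and later contradicts the decay of \<open>\<tau>\<close>.\<close>
  have inv: "good_state \<Psi> y xstar (2 * \<tau> k) (x k) (d k) \<and> m \<le> 2 * \<tau> k" for k
  proof (induction k)
    case 0
    have "\<bar>(transpose \<Psi> *v y) $ i - xstar $ i\<bar> \<le> D / 2"
      if "good_state \<Psi> y xstar D 0 (transpose \<Psi> *v y)" "m \<le> D" for D i
    proof -
      have "t \<le> 1 / 2" using t by linarith
      then have "t * D \<le> 1 / 2 * D" using that(2) \<open>0 < m\<close> by (intro mult_right_mono) auto
      then show ?thesis using err[OF that, of i] by simp
    qed
    from good_state_initial[OF this m_le ne assms(16)] show ?case by (simp add: x0 \<tau>_def)
  next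
    case (Suc k)
    then have "0 \<le> \<tau> k" using \<open>0 < m\<close> by linarith
    \<comment> \<open>The lower end of the interval for \<open>sqrt \<rho>\<close> is
      \<open>2 * t\<close>: the error allowed by the old bound then fits within the new
      threshold.\<close>
    then have shrink: "t * (2 * \<tau> k) \<le> \<tau> (Suc k)" "\<tau> (Suc k) \<le> \<tau> k"
      using mult_right_mono[of "2 * t" "sqrt \<rho>" "\<tau> k"] mult_right_mono[of "sqrt \<rho>" 1 "\<tau> k"] t
      by (simp_all add: \<tau>_Suc algebra_simps)
    have "\<bar>x' $ i + d' $ i - xstar $ i\<bar> \<le> \<tau> (Suc k)"
      if "good_state \<Psi> y xstar (2 * \<tau> k) x' d'" for x' d' i
      using err[OF that, of i] Suc shrink(1) by linarith
    then have good: "good_state \<Psi> y xstar (2 * \<tau> (Suc k)) (x (Suc k)) (d (Suc k))"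
      using pdas_inner_loop_good_state[OF loop conjunct1[OF Suc]] shrink(2)
      by (simp add: \<tau>_def[of "Suc k"])
    obtain i where "i \<in> supp xstar" "\<bar>xstar $ i\<bar> \<le> 2 * \<tau> (Suc k)"
      by (rule good_state_not_stop[OF good y assms(7) nostop]) simp_all
    with good show ?case using m_le[of i] by linarith
  qed
  have \<tau>: "\<tau> k = sqrt \<rho> ^ k * \<tau> 0" for k
    by (induction k) (simp_all add: \<tau>_Suc)
  \<comment> \<open>The doubled thresholds tend to 0, while the invariant keeps them above
    \<open>m\<close>, which is positive.\<close>
  have "(\<lambda>k. 2 * (sqrt \<rho> ^ k * \<tau> 0)) \<longlonglongrightarrow> 2 * (0 * \<tau> 0)"
    using t assms(13) by (intro tendsto_intros LIMSEQ_power_zero) auto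
  then have "m \<le> 2 * (0 * \<tau> 0)"
    by (rule LIMSEQ_le_const) (use inv in \<open>simp flip: \<tau>\<close>)
  then show False using \<open>0 < m\<close> by simp
qed

end
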